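(* Let $\alpha$ be an ordinal. An ultraproduct of representable substitution algebras of dimension $\alpha$ is a representable substitution algebra of dimension $\alpha$.
   Context: For a nonempty set $U$, $F_\alpha(U)$ is the set of all functions $U^\alpha\to U$. For $s\in U^\alpha$, $\kappa<\alpha$, $x\in U$, $s\langle\kappa,x\rangle$ agrees with $s$ except that its $\kappa$-th entry is $x$. On $F_\alpha(U)$ set $(f*_\kappa g)(s)=g(s\langle\kappa,f(s)\rangle)$ and $V_\kappa(s)=s_\kappa$. A function substitution algebra of dimension $\alpha$ ($FSA_\alpha$) is $\langle A,*_\kappa,V_\kappa\rangle_{\kappa<\alpha}$ with $A\subseteq F_\alpha(U)$ closed under every $*_\kappa$ and containing every $V_\kappa$. A substitution algebra of dimension $\alpha$ ($SA_\alpha$) is an algebra $\langle A,*_\kappa,v_\kappa\rangle_{\kappa<\alpha}$ satisfying, for all $\kappa,\lambda<\alpha$: (1) $x*_\kappa v_\kappa=x$; (2) $x*_\kappa v_\lambda=v_\lambda$ for $\kappa\neq\lambda$; (3) $v_\kappa*_\kappa x=x$; (4) if $w*_\lambda x=x$ for all $w$, then $x*_\lambda(v_\lambda*_\kappa z)=x*_\lambda(x*_\kappa z)$; (5) $(x*_\kappa y)*_\kappa z=x*_\kappa(y*_\kappa z)$; (6) if $w*_\lambda x=x$ for all $w$, then $x*_\kappa(y*_\lambda z)=(x*_\kappa y)*_\lambda(x*_\kappa z)$ for $\kappa\neq\lambda$. An $SA_\alpha$ is representable if it is isomorphic to an $FSA_\alpha$. *)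

theory Defs
  imports Main "HOL-Library.FuncSet"
begin

text \<open>
  An ordinal is given as a well-order \<open>\<alpha>\<close> in the sense of \<open>Well_order\<close>; the indices
  \<open>\<kappa> < \<alpha>\<close> are the elements of \<open>Field \<alpha>\<close>, which may be empty, finite or infinite.
  Only the values of \<open>star\<close> and \<open>var\<close> at indices in \<open>Field \<alpha>\<close> and at arguments in \<open>carr\<close>
  are ever relevant.
\<close>

record ('k, 'a) sub_alg =
  carr :: "'a set"
  star :: "'k \<Rightarrow> 'a \<Rightarrow> 'a \<Rightarrow> 'a"
  var :: "'k \<Rightarrow> 'a"

text \<open>The universe of an algebra is nonempty; this is a restriction only if \<open>Field \<alpha> = {}\<close>.\<close>

definition is_SA :: "'k rel \<Rightarrow> ('k, 'a) sub_alg \<Rightarrow> bool" where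
  "is_SA \<alpha> A \<longleftrightarrow>
     carr A \<noteq> {} \<and>
     (\<forall>\<kappa>\<in>Field \<alpha>. \<forall>x\<in>carr A. \<forall>y\<in>carr A. star A \<kappa> x y \<in> carr A) \<and>
     (\<forall>\<kappa>\<in>Field \<alpha>. var A \<kappa> \<in> carr A) \<and>
     (\<forall>\<kappa>\<in>Field \<alpha>. \<forall>x\<in>carr A. star A \<kappa> x (var A \<kappa>) = x) \<and>
     (\<forall>\<kappa>\<in>Field \<alpha>. \<forall>\<mu>\<in>Field \<alpha>. \<forall>x\<in>carr A.
        \<kappa> \<noteq> \<mu> \<longrightarrow> star A \<kappa> x (var A \<mu>) = var A \<mu>) \<and>
     (\<forall>\<kappa>\<in>Field \<alpha>. \<forall>x\<in>carr A. star A \<kappa> (var A \<kappa>) x = x) \<and>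
     (\<forall>\<kappa>\<in>Field \<alpha>. \<forall>\<mu>\<in>Field \<alpha>. \<forall>x\<in>carr A. \<forall>z\<in>carr A.
        (\<forall>w\<in>carr A. star A \<mu> w x = x) \<longrightarrow>
        star A \<mu> x (star A \<kappa> (var A \<mu>) z) = star A \<mu> x (star A \<kappa> x z)) \<and>
     (\<forall>\<kappa>\<in>Field \<alpha>. \<forall>x\<in>carr A. \<forall>y\<in>carr A. \<forall>z\<in>carr A.
        star A \<kappa> (star A \<kappa> x y) z = star A \<kappa> x (star A \<kappa> y z)) \<and>
     (\<forall>\<kappa>\<in>Field \<alpha>. \<forall>\<mu>\<in>Field \<alpha>. \<forall>x\<in>carr A. \<forall>y\<in>carr A. \<forall>z\<in>carr A.
        \<kappa> \<noteq> \<mu> \<longrightarrow> (\<forall>w\<in>carr A. star A \<mu> w x = x) \<longrightarrow>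
        star A \<kappa> x (star A \<mu> y z) = star A \<mu> (star A \<kappa> x y) (star A \<kappa> x z))"

definition seqs :: "'k rel \<Rightarrow> 'u set \<Rightarrow> ('k \<Rightarrow> 'u) set" where
  "seqs \<alpha> U = Field \<alpha> \<rightarrow>\<^sub>E U"

definition funs :: "'k rel \<Rightarrow> 'u set \<Rightarrow> (('k \<Rightarrow> 'u) \<Rightarrow> 'u) set" where
  "funs \<alpha> U = seqs \<alpha> U \<rightarrow>\<^sub>E U"

definition fun_star ::
  "'k rel \<Rightarrow> 'u set \<Rightarrow> 'k \<Rightarrow> (('k \<Rightarrow> 'u) \<Rightarrow> 'u) \<Rightarrow> (('k \<Rightarrow> 'u) \<Rightarrow> 'u) \<Rightarrow> (('k \<Rightarrow> 'u) \<Rightarrow> 'u)" where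
  "fun_star \<alpha> U \<kappa> f g = (\<lambda>s\<in>seqs \<alpha> U. g (s(\<kappa> := f s)))"

definition fun_var :: "'k rel \<Rightarrow> 'u set \<Rightarrow> 'k \<Rightarrow> (('k \<Rightarrow> 'u) \<Rightarrow> 'u)" where
  "fun_var \<alpha> U \<kappa> = (\<lambda>s\<in>seqs \<alpha> U. s \<kappa>)"

definition is_FSA :: "'k rel \<Rightarrow> 'u set \<Rightarrow> ('k, ('k \<Rightarrow> 'u) \<Rightarrow> 'u) sub_alg \<Rightarrow> bool" where
  "is_FSA \<alpha> U B \<longleftrightarrow>
     U \<noteq> {} \<and> carr B \<subseteq> funs \<alpha> U \<and>
     (\<forall>\<kappa>\<in>Field \<alpha>. \<forall>f\<in>carr B. \<forall>g\<in>carr B. star B \<kappa> f g = fun_star \<alpha> U \<kappa> f g) \<and>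
     (\<forall>\<kappa>\<in>Field \<alpha>. var B \<kappa> = fun_var \<alpha> U \<kappa>) \<and>
     (\<forall>\<kappa>\<in>Field \<alpha>. \<forall>f\<in>carr B. \<forall>g\<in>carr B. fun_star \<alpha> U \<kappa> f g \<in> carr B) \<and>
     (\<forall>\<kappa>\<in>Field \<alpha>. fun_var \<alpha> U \<kappa> \<in> carr B)"

definition sub_alg_iso ::
  "'k rel \<Rightarrow> ('a \<Rightarrow> 'b) \<Rightarrow> ('k, 'a) sub_alg \<Rightarrow> ('k, 'b) sub_alg \<Rightarrow> bool" where
  "sub_alg_iso \<alpha> h A B \<longleftrightarrow>
     bij_betw h (carr A) (carr B) \<and>
     (\<forall>\<kappa>\<in>Field \<alpha>. \<forall>x\<in>carr A. \<forall>y\<in>carr A. h (star A \<kappa> x y) = star B \<kappa> (h x) (h y)) \<and>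
     (\<forall>\<kappa>\<in>Field \<alpha>. h (var A \<kappa>) = var B \<kappa>)"

text \<open>
  HOL cannot quantify over types inside a formula, so the type \<open>'u\<close> whose subsets serve as
  base sets is an explicit parameter of representability.  For an ultraproduct of algebras
  represented over \<open>U i :: 'u set\<close>, the type \<open>('k \<Rightarrow> 'i \<Rightarrow> 'u) \<Rightarrow> ('i \<Rightarrow> 'u) set\<close> is large
  enough: it contains the power, with one factor for each \<open>'k \<Rightarrow> 'i \<Rightarrow> 'u\<close>, of the ultraproduct
  of the sets \<open>U i\<close>.
\<close>

definition representable_SA :: "'u itself \<Rightarrow> 'k rel \<Rightarrow> ('k, 'a) sub_alg \<Rightarrow> bool" where
  "representable_SA T \<alpha> A \<longleftrightarrow>
     is_SA \<alpha> A \<and> (\<exists>(U :: 'u set) B h. is_FSA \<alpha> U B \<and> sub_alg_iso \<alpha> h A B)"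

definition ultrafilter_on :: "'i set \<Rightarrow> 'i filter \<Rightarrow> bool" where
  "ultrafilter_on I D \<longleftrightarrow>
     D \<noteq> bot \<and> D \<le> principal I \<and>
     (\<forall>P. eventually P D \<or> eventually (\<lambda>i. \<not> P i) D)"

definition ultra_rel ::
  "'i set \<Rightarrow> 'i filter \<Rightarrow> ('i \<Rightarrow> ('k, 'a) sub_alg) \<Rightarrow> ('i \<Rightarrow> 'a) rel" where
  "ultra_rel I D A =
     {(x, y). x \<in> (\<Pi>\<^sub>E i\<in>I. carr (A i)) \<and> y \<in> (\<Pi>\<^sub>E i\<in>I. carr (A i)) \<and>
              eventually (\<lambda>i. x i = y i) D}"

text \<open>
  The operation on classes is the union of the classes of the coordinatewise results over all
  representatives; these classes coincide, since the equivalence is a congruence.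
\<close>

definition ultraproduct ::
  "'i set \<Rightarrow> 'i filter \<Rightarrow> ('i \<Rightarrow> ('k, 'a) sub_alg) \<Rightarrow> ('k, ('i \<Rightarrow> 'a) set) sub_alg" where
  "ultraproduct I D A =
     \<lparr> carr = (\<Pi>\<^sub>E i\<in>I. carr (A i)) // ultra_rel I D A,
       star = (\<lambda>\<kappa> X Y. \<Union>x\<in>X. \<Union>y\<in>Y. ultra_rel I D A `` {\<lambda>i\<in>I. star (A i) \<kappa> (x i) (y i)}),
       var = (\<lambda>\<kappa>. ultra_rel I D A `` {\<lambda>i\<in>I. var (A i) \<kappa>}) \<rparr>"

end

theory Submission
  imports Defs
begin

text \<open>
  Represent each factor \<open>A i\<close> by functions over \<open>U i\<close>, and let \<open>U*\<close> be the ultraproduct of the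
  sets \<open>U i\<close>.  An element of the ultraproduct acts coordinatewise on sequences of representatives,
  but for infinite \<open>\<alpha>\<close> the result depends on the representatives chosen.  If the representative of
  an entry depends only on its position \<open>\<kappa>\<close> and on its class, then changing one entry of a
  sequence changes only one representative, and the action becomes a homomorphism into the
  functions over \<open>U*\<close>.  One such homomorphism need not be injective; but if \<open>x\<close> and \<open>y\<close> differ in
  the ultraproduct, a choice of representatives that passes through points \<open>t\<close> where the
  coordinates of \<open>x\<close> and \<open>y\<close> differ separates them.  Since products of function substitution
  algebras are again such algebras (over the product of the base sets), all choices together, one
  for each \<open>t\<close>, give a faithful representation over a power of \<open>U*\<close>.
\<close>

section \<open>Faithful representations as evaluation maps\<close>

text \<open>A representation is recorded by its evaluation \<open>e\<close>, whose values matter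
  only on \<open>seqs \<alpha> U\<close>. This avoids naming the image algebra and keeping its
  functions extensional; the axioms of a substitution algebra then follow from faithfulness.\<close>

locale function_rep =
  fixes \<alpha> :: "'k rel" and A :: "('k, 'a) sub_alg"
    and U :: "'u set" and e :: "'a \<Rightarrow> ('k \<Rightarrow> 'u) \<Rightarrow> 'u"
  assumes base_nonempty: "U \<noteq> {}"
    and carr_nonempty: "carr A \<noteq> {}"
    and star_closed: "\<lbrakk>\<kappa> \<in> Field \<alpha>; x \<in> carr A; y \<in> carr A\<rbrakk> \<Longrightarrow> star A \<kappa> x y \<in> carr A"
    and var_closed: "\<kappa> \<in> Field \<alpha> \<Longrightarrow> var A \<kappa> \<in> carr A"
    and eval_closed: "\<lbrakk>x \<in> carr A; s \<in> seqs \<alpha> U\<rbrakk> \<Longrightarrow> e x s \<in> U"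
    and eval_star: "\<lbrakk>\<kappa> \<in> Field \<alpha>; x \<in> carr A; y \<in> carr A; s \<in> seqs \<alpha> U\<rbrakk>
          \<Longrightarrow> e (star A \<kappa> x y) s = e y (s(\<kappa> := e x s))"
    and eval_var: "\<lbrakk>\<kappa> \<in> Field \<alpha>; s \<in> seqs \<alpha> U\<rbrakk> \<Longrightarrow> e (var A \<kappa>) s = s \<kappa>"
    and eval_inject: "\<lbrakk>x \<in> carr A; y \<in> carr A; \<And>s. s \<in> seqs \<alpha> U \<Longrightarrow> e x s = e y s\<rbrakk> \<Longrightarrow> x = y"

lemma seqs_upd: "\<lbrakk>s \<in> seqs \<alpha> U; u \<in> U; \<kappa> \<in> Field \<alpha>\<rbrakk> \<Longrightarrow> s(\<kappa> := u) \<in> seqs \<alpha> U"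
  by (auto simp: seqs_def PiE_iff extensional_def)

context function_rep
begin

text \<open>By \<open>eval_inject\<close> each axiom may be checked pointwise, where it becomes an
  identity between updated sequences.\<close>

lemma is_SA: "is_SA \<alpha> A"
proof -
  \<comment> \<open>The side condition of axioms (4) and (6) gives independence of entry \<mu> only
    for new values of the form \<open>e w s\<close>. This suffices: (4) uses it with
    \<open>w\<close> equal to \<open>x\<close>, and (6) with \<open>w\<close> equal to
    \<open>star A \<kappa> x y\<close>.\<close>
  have abs: "e x (s(\<mu> := e w s)) = e x s"
    if "\<forall>w\<in>carr A. star A \<mu> w x = x" "w \<in> carr A" "x \<in> carr A" "\<mu> \<in> Field \<alpha>" "s \<in> seqs \<alpha> U"
    for \<mu> w x s
    using that eval_star[of \<mu> w x s] by simp
  note [simp] = star_closed var_closed eval_closed eval_star eval_var seqs_upd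
  have 1: "star A \<kappa> x (var A \<kappa>) = x" if "\<kappa> \<in> Field \<alpha>" "x \<in> carr A" for \<kappa> x
    by (rule eval_inject) (use that in simp_all)
  have 2: "star A \<kappa> x (var A \<mu>) = var A \<mu>"
    if "\<kappa> \<in> Field \<alpha>" "\<mu> \<in> Field \<alpha>" "x \<in> carr A" "\<kappa> \<noteq> \<mu>" for \<kappa> \<mu> x
    by (rule eval_inject) (use that in simp_all)
  have 3: "star A \<kappa> (var A \<kappa>) x = x" if "\<kappa> \<in> Field \<alpha>" "x \<in> carr A" for \<kappa> x
    by (rule eval_inject) (use that in simp_all)
  have 4: "star A \<mu> x (star A \<kappa> (var A \<mu>) z) = star A \<mu> x (star A \<kappa> x z)"
    if "\<kappa> \<in> Field \<alpha>" "\<mu> \<in> Field \<alpha>" "x \<in> carr A" "z \<in> carr A"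
      "\<forall>w\<in>carr A. star A \<mu> w x = x" for \<kappa> \<mu> x z
    by (rule eval_inject) (use that abs[of \<mu> x x] in simp_all)
  have 5: "star A \<kappa> (star A \<kappa> x y) z = star A \<kappa> x (star A \<kappa> y z)"
    if "\<kappa> \<in> Field \<alpha>" "x \<in> carr A" "y \<in> carr A" "z \<in> carr A" for \<kappa> x y z
    by (rule eval_inject) (use that in simp_all)
  have 6: "star A \<kappa> x (star A \<mu> y z) = star A \<mu> (star A \<kappa> x y) (star A \<kappa> x z)"
    if "\<kappa> \<in> Field \<alpha>" "\<mu> \<in> Field \<alpha>" "x \<in> carr A" "y \<in> carr A" "z \<in> carr A" "\<kappa> \<noteq> \<mu>"
      "\<forall>w\<in>carr A. star A \<mu> w x = x" for \<kappa> \<mu> x y z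
    by (rule eval_inject) (use that abs[of \<mu> x "star A \<kappa> x y"] in \<open>simp_all add: fun_upd_twist\<close>)
  show ?thesis
    unfolding is_SA_def
    using carr_nonempty by (intro conjI ballI impI) (simp_all add: 1 2 3 4 5 6)
qed

lemma representable: "representable_SA TYPE('u) \<alpha> A"
proof -
  \<comment> \<open>Restriction makes the functions extensional, so that agreement on
    \<open>seqs \<alpha> U\<close> is equality in \<open>funs \<alpha> U\<close>.\<close>
  define h where "h x = (\<lambda>s\<in>seqs \<alpha> U. e x s)" for x
  define B where "B = \<lparr>carr = h ` carr A, star = fun_star \<alpha> U, var = fun_var \<alpha> U\<rparr>"
  have star: "h (star A \<kappa> x y) = fun_star \<alpha> U \<kappa> (h x) (h y)"
    if "\<kappa> \<in> Field \<alpha>" "x \<in> carr A" "y \<in> carr A" for \<kappa> x y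
    unfolding h_def fun_star_def
    by (rule restrict_ext) (use that in \<open>simp add: eval_star seqs_upd eval_closed\<close>)
  have var: "h (var A \<kappa>) = fun_var \<alpha> U \<kappa>" if "\<kappa> \<in> Field \<alpha>" for \<kappa>
    unfolding h_def fun_var_def by (rule restrict_ext) (use that in \<open>simp add: eval_var\<close>)
  have "is_FSA \<alpha> U B"
    unfolding is_FSA_def
  proof (intro conjI ballI)
    show "carr B \<subseteq> funs \<alpha> U"
      by (auto simp: B_def h_def funs_def eval_closed)
    show "fun_star \<alpha> U \<kappa> f g \<in> carr B" if "\<kappa> \<in> Field \<alpha>" "f \<in> carr B" "g \<in> carr B" for \<kappa> f g
      using that by (auto simp: B_def star_closed star[symmetric])
    show "fun_var \<alpha> U \<kappa> \<in> carr B" if "\<kappa> \<in> Field \<alpha>" for \<kappa>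
      using that by (auto simp: B_def var_closed var[symmetric])
  qed (simp_all add: B_def base_nonempty)
  moreover have "sub_alg_iso \<alpha> h A B"
  proof -
    have "inj_on h (carr A)"
      by (rule inj_onI, rule eval_inject) (auto simp: h_def dest: fun_cong split: if_splits)
    then show ?thesis
      by (simp add: sub_alg_iso_def B_def bij_betw_def star var)
  qed
  ultimately show ?thesis
    using is_SA unfolding representable_SA_def by blast
qed

end

text \<open>The values of an isomorphism onto a function substitution algebra are functions, so the
  isomorphism itself serves as the evaluation.\<close>

lemma representable_function_rep:
  assumes "representable_SA TYPE('u) \<alpha> A"
  shows "\<exists>(U :: 'u set) e. function_rep \<alpha> A U e"
proof -
  obtain U :: "'u set" and B h where SA: "is_SA \<alpha> A" and FSA: "is_FSA \<alpha> U B"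
    and iso: "sub_alg_iso \<alpha> h A B"
    using assms unfolding representable_SA_def by blast
  have bij: "bij_betw h (carr A) (carr B)"
    using iso by (simp add: sub_alg_iso_def)
  have hB: "h x \<in> carr B" if "x \<in> carr A" for x
    using bij that by (auto simp: bij_betw_def)
  have funs: "h x \<in> seqs \<alpha> U \<rightarrow>\<^sub>E U" if "x \<in> carr A" for x
    using hB[OF that] FSA by (auto simp: is_FSA_def funs_def)
  have "function_rep \<alpha> A U h"
  proof
    show "h (star A \<kappa> x y) s = h y (s(\<kappa> := h x s))"
      if "\<kappa> \<in> Field \<alpha>" "x \<in> carr A" "y \<in> carr A" "s \<in> seqs \<alpha> U" for \<kappa> x y s
      using that iso FSA hB by (simp add: sub_alg_iso_def is_FSA_def fun_star_def)
    show "h (var A \<kappa>) s = s \<kappa>" if "\<kappa> \<in> Field \<alpha>" "s \<in> seqs \<alpha> U" for \<kappa> s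
      using that iso FSA by (simp add: sub_alg_iso_def is_FSA_def fun_var_def)
    show "x = y"
      if "x \<in> carr A" "y \<in> carr A" "\<And>s. s \<in> seqs \<alpha> U \<Longrightarrow> h x s = h y s" for x y
    proof -
      have "h x = h y"
        using funs[OF that(1)] funs[OF that(2)] that(3) by (rule PiE_ext)
      then show ?thesis
        using bij that(1,2) by (auto simp: bij_betw_def inj_on_def)
    qed
    show "h x s \<in> U" if "x \<in> carr A" "s \<in> seqs \<alpha> U" for x s
      using funs[OF that(1)] that(2) by (rule PiE_mem)
    show "U \<noteq> {}"
      using FSA by (simp add: is_FSA_def)
  qed (use SA in \<open>simp_all add: is_SA_def\<close>)
  then show ?thesis
    by blast
qed

section \<open>Reduced products and the operations on classes\<close>

text \<open>Stated for any family of sets, since it is applied both to the carriers and to the base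
  sets \<open>U i\<close>.\<close>

definition filter_rel :: "'i set \<Rightarrow> 'i filter \<Rightarrow> ('i \<Rightarrow> 'b set) \<Rightarrow> ('i \<Rightarrow> 'b) rel" where
  "filter_rel I D S = {(x, y). x \<in> Pi\<^sub>E I S \<and> y \<in> Pi\<^sub>E I S \<and> eventually (\<lambda>i. x i = y i) D}"

lemma ultra_rel_eq: "ultra_rel I D A = filter_rel I D (\<lambda>i. carr (A i))"
  by (simp add: ultra_rel_def filter_rel_def)

lemma equiv_filter_rel: "equiv (Pi\<^sub>E I S) (filter_rel I D S)"
proof (rule equivI)
  show "filter_rel I D S \<subseteq> Pi\<^sub>E I S \<times> Pi\<^sub>E I S"
    by (auto simp: filter_rel_def)
  show "refl_on (Pi\<^sub>E I S) (filter_rel I D S)"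
    by (auto simp: refl_on_def filter_rel_def)
  show "sym (filter_rel I D S)"
    by (auto simp: sym_def filter_rel_def eq_commute)
  show "trans (filter_rel I D S)"
    by (rule transI) (auto simp: filter_rel_def elim: eventually_elim2)
qed

lemma filter_rel_class_eq_iff:
  assumes "x \<in> Pi\<^sub>E I S" "y \<in> Pi\<^sub>E I S"
  shows "filter_rel I D S `` {x} = filter_rel I D S `` {y} \<longleftrightarrow> eventually (\<lambda>i. x i = y i) D"
  using eq_equiv_class_iff[OF equiv_filter_rel assms, of D] assms by (simp add: filter_rel_def)

lemma carr_ultraproduct:
  "carr (ultraproduct I D A) = (\<Pi>\<^sub>E i\<in>I. carr (A i)) // filter_rel I D (\<lambda>i. carr (A i))"
  by (simp add: ultraproduct_def ultra_rel_eq)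

lemma var_ultraproduct:
  "var (ultraproduct I D A) \<kappa> = filter_rel I D (\<lambda>i. carr (A i)) `` {\<lambda>i\<in>I. var (A i) \<kappa>}"
  by (simp add: ultraproduct_def ultra_rel_eq)

text \<open>Two equations that hold D-almost everywhere hold together D-almost everywhere, so the
  coordinatewise operation respects the equivalence and the union over representatives collapses to
  one class.\<close>

lemma star_ultraproduct:
  fixes I :: "'i set" and D :: "'i filter" and A :: "'i \<Rightarrow> ('k, 'a) sub_alg"
  defines "R \<equiv> filter_rel I D (\<lambda>i. carr (A i))"
  assumes closed: "\<And>i x y. \<lbrakk>i \<in> I; x \<in> carr (A i); y \<in> carr (A i)\<rbrakk> \<Longrightarrow> star (A i) \<kappa> x y \<in> carr (A i)"
    and x: "x \<in> (\<Pi>\<^sub>E i\<in>I. carr (A i))" and y: "y \<in> (\<Pi>\<^sub>E i\<in>I. carr (A i))"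
  shows "star (ultraproduct I D A) \<kappa> (R `` {x}) (R `` {y})
         = R `` {\<lambda>i\<in>I. star (A i) \<kappa> (x i) (y i)}"
proof -
  have equiv: "equiv (\<Pi>\<^sub>E i\<in>I. carr (A i)) R"
    unfolding R_def by (rule equiv_filter_rel)
  have "congruent2 R R (\<lambda>x y. R `` {\<lambda>i\<in>I. star (A i) \<kappa> (x i) (y i)})"
  proof (rule congruent2I')
    fix x x' y y' assume *: "(x, x') \<in> R" "(y, y') \<in> R"
    have "eventually (\<lambda>i. (\<lambda>i\<in>I. star (A i) \<kappa> (x i) (y i)) i
                        = (\<lambda>i\<in>I. star (A i) \<kappa> (x' i) (y' i)) i) D"
      using * unfolding R_def filter_rel_def by (auto elim: eventually_elim2)
    then show "R `` {\<lambda>i\<in>I. star (A i) \<kappa> (x i) (y i)} = R `` {\<lambda>i\<in>I. star (A i) \<kappa> (x' i) (y' i)}"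
      unfolding R_def
      by (subst filter_rel_class_eq_iff)
        (use * in \<open>auto simp: R_def filter_rel_def intro!: closed\<close>)
  qed
  from UN_equiv_class2[OF equiv equiv this x y] show ?thesis
    by (simp add: ultraproduct_def ultra_rel_eq R_def)
qed

section \<open>Representatives of sequences of classes\<close>

text \<open>The preference for \<open>t \<kappa>\<close> lets a prescribed sequence of points be
  recovered from its classes; in all other cases any fixed member of the class will do.\<close>

definition choose_rep :: "('k \<Rightarrow> 'b) \<Rightarrow> 'k \<Rightarrow> 'b set \<Rightarrow> 'b" where
  "choose_rep t \<kappa> X = (if t \<kappa> \<in> X then t \<kappa> else SOME x. x \<in> X)"

lemma choose_rep_mem: "X \<noteq> {} \<Longrightarrow> choose_rep t \<kappa> X \<in> X"
  by (auto simp: choose_rep_def intro: someI_ex)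

definition lift_seq ::
  "'k rel \<Rightarrow> ('k \<Rightarrow> 'i \<Rightarrow> 'u) \<Rightarrow> ('k \<Rightarrow> ('k \<Rightarrow> 'i \<Rightarrow> 'u) \<Rightarrow> ('i \<Rightarrow> 'u) set) \<Rightarrow> 'i \<Rightarrow> 'k \<Rightarrow> 'u" where
  "lift_seq \<alpha> t s i = (\<lambda>\<kappa>\<in>Field \<alpha>. choose_rep t \<kappa> (s \<kappa> t) i)"

text \<open>The representative of an entry depends only on \<open>t\<close>, the position and that
  entry, so an update leaves all other representatives untouched.\<close>

lemma lift_seq_upd:
  "\<kappa> \<in> Field \<alpha> \<Longrightarrow>
     lift_seq \<alpha> t (s(\<kappa> := u)) i = (lift_seq \<alpha> t s i)(\<kappa> := choose_rep t \<kappa> (u t) i)"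
  by (auto simp: lift_seq_def fun_eq_iff)

text \<open>The power of the ultraproduct of the \<open>U i\<close> with one factor for each choice
  parameter \<open>t\<close>.\<close>

definition ultra_base ::
  "'i set \<Rightarrow> 'i filter \<Rightarrow> ('i \<Rightarrow> 'u set) \<Rightarrow> (('k \<Rightarrow> 'i \<Rightarrow> 'u) \<Rightarrow> ('i \<Rightarrow> 'u) set) set" where
  "ultra_base I D U = {u. \<forall>t. u t \<in> Pi\<^sub>E I U // filter_rel I D U}"

definition ultra_eval ::
  "'k rel \<Rightarrow> 'i set \<Rightarrow> 'i filter \<Rightarrow> ('i \<Rightarrow> 'u set) \<Rightarrow> ('i \<Rightarrow> 'a \<Rightarrow> ('k \<Rightarrow> 'u) \<Rightarrow> 'u) \<Rightarrow>
   ('i \<Rightarrow> 'a) set \<Rightarrow> ('k \<Rightarrow> ('k \<Rightarrow> 'i \<Rightarrow> 'u) \<Rightarrow> ('i \<Rightarrow> 'u) set) \<Rightarrow>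
   ('k \<Rightarrow> 'i \<Rightarrow> 'u) \<Rightarrow> ('i \<Rightarrow> 'u) set" where
  "ultra_eval \<alpha> I D U e X s =
     (\<lambda>t. \<Union>x\<in>X. filter_rel I D U `` {\<lambda>i\<in>I. e i (x i) (lift_seq \<alpha> t s i)})"

lemma choose_rep_class:
  assumes "X \<in> Pi\<^sub>E I S // filter_rel I D S"
  shows "choose_rep t \<kappa> X \<in> Pi\<^sub>E I S" "filter_rel I D S `` {choose_rep t \<kappa> X} = X"
proof -
  have "choose_rep t \<kappa> X \<in> X"
    using in_quotient_imp_non_empty[OF equiv_filter_rel assms] by (rule choose_rep_mem)
  then show "choose_rep t \<kappa> X \<in> Pi\<^sub>E I S" "filter_rel I D S `` {choose_rep t \<kappa> X} = X"
    using in_quotient_imp_subset[OF equiv_filter_rel assms] Image_singleton_iff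
      quotientE[OF assms] equiv_class_eq[OF equiv_filter_rel[of I S D]]
    by (blast, metis)
qed

lemma seqs_ultra_base:
  assumes "s \<in> seqs \<alpha> (ultra_base I D U)" "\<kappa> \<in> Field \<alpha>"
  shows "s \<kappa> t \<in> Pi\<^sub>E I U // filter_rel I D U"
  using assms by (auto simp: seqs_def ultra_base_def)

lemma lift_seq_in_seqs:
  assumes "s \<in> seqs \<alpha> (ultra_base I D U)" "i \<in> I"
  shows "lift_seq \<alpha> t s i \<in> seqs \<alpha> (U i)"
proof -
  have "choose_rep t \<kappa> (s \<kappa> t) i \<in> U i" if "\<kappa> \<in> Field \<alpha>" for \<kappa>
    using choose_rep_class(1)[OF seqs_ultra_base[OF assms(1) that]] assms(2) by (rule PiE_mem)
  then show ?thesis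
    by (simp add: lift_seq_def seqs_def)
qed

section \<open>The representation of the ultraproduct\<close>

text \<open>The equations for \<open>star\<close> and \<open>var\<close> hold in each component
  \<open>t\<close> separately; injectivity is read off from a single component, whose
  \<open>t\<close> is built from separating points.\<close>

lemma function_rep_ultraproduct:
  fixes U :: "'i \<Rightarrow> 'u set" and A :: "'i \<Rightarrow> ('k, 'a) sub_alg"
  assumes D: "D \<le> principal I"
    and rep: "\<And>i. i \<in> I \<Longrightarrow> function_rep \<alpha> (A i) (U i) (e i)"
  shows "function_rep \<alpha> (ultraproduct I D A) (ultra_base I D U) (ultra_eval \<alpha> I D U e)"
proof -
  let ?PA = "\<Pi>\<^sub>E i\<in>I. carr (A i)" and ?PU = "Pi\<^sub>E I U"
  let ?RA = "filter_rel I D (\<lambda>i. carr (A i))" and ?RU = "filter_rel I D U"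
  let ?base = "ultra_base I D U :: (('k \<Rightarrow> 'i \<Rightarrow> 'u) \<Rightarrow> ('i \<Rightarrow> 'u) set) set"
  let ?E = "ultra_eval \<alpha> I D U e"
  let ?v = "\<lambda>x t s. \<lambda>i\<in>I. e i (x i) (lift_seq \<alpha> t s i)"
  have ev_I: "eventually (\<lambda>i. i \<in> I) D"
    using D by (simp add: le_principal)
  have PA_nonempty: "?PA \<noteq> {}" and PU_nonempty: "?PU \<noteq> {}"
    using function_rep.carr_nonempty[OF rep] function_rep.base_nonempty[OF rep]
    by (auto simp: PiE_eq_empty_iff)
  have star_PA: "(\<lambda>i\<in>I. star (A i) \<kappa> (x i) (y i)) \<in> ?PA"
    if "\<kappa> \<in> Field \<alpha>" "x \<in> ?PA" "y \<in> ?PA" for \<kappa> x y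
    using that by (auto intro!: function_rep.star_closed[OF rep])
  have var_PA: "(\<lambda>i\<in>I. var (A i) \<kappa>) \<in> ?PA" if "\<kappa> \<in> Field \<alpha>" for \<kappa>
    using that by (auto intro!: function_rep.var_closed[OF rep])
  have star_class: "star (ultraproduct I D A) \<kappa> (?RA `` {x}) (?RA `` {y})
      = ?RA `` {\<lambda>i\<in>I. star (A i) \<kappa> (x i) (y i)}"
    if "\<kappa> \<in> Field \<alpha>" "x \<in> ?PA" "y \<in> ?PA" for \<kappa> x y
    using that by (intro star_ultraproduct function_rep.star_closed[OF rep])
  have v_PU: "?v x t s \<in> ?PU" if "x \<in> ?PA" "s \<in> seqs \<alpha> ?base" for x t s
    using that by (auto intro!: function_rep.eval_closed[OF rep] lift_seq_in_seqs)
  \<comment> \<open>Another representative of the class of \<open>x\<close> differs from it only on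
    a D-null set of coordinates, while the lift of \<open>s\<close> stays the same; hence one
    representative computes the union.\<close>
  have E_class: "?E (?RA `` {x}) s t = ?RU `` {?v x t s}"
    if "x \<in> ?PA" "s \<in> seqs \<alpha> ?base" for x t s
    unfolding ultra_eval_def
  proof (rule UN_equiv_class[OF equiv_filter_rel _ that(1)], rule congruentI)
    fix y z assume yz: "(y, z) \<in> ?RA"
    then have y: "y \<in> ?PA" and z: "z \<in> ?PA" and "eventually (\<lambda>i. y i = z i) D"
      by (auto simp: filter_rel_def)
    then have "eventually (\<lambda>i. ?v y t s i = ?v z t s i) D"
      by (auto elim: eventually_mono)
    then show "?RU `` {?v y t s} = ?RU `` {?v z t s}"
      by (rule filter_rel_class_eq_iff[OF v_PU[OF y that(2)] v_PU[OF z that(2)], THEN iffD2])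
  qed
  have E_base: "?E (?RA `` {x}) s \<in> ?base" if "x \<in> ?PA" "s \<in> seqs \<alpha> ?base" for x s
    by (simp only: ultra_base_def mem_Collect_eq E_class[OF that] quotientI v_PU[OF that] simp_thms)
  show ?thesis
  proof
    show "?base \<noteq> {}"
    proof -
      obtain z where "z \<in> ?PU"
        using PU_nonempty by blast
      then have "(\<lambda>t. ?RU `` {z}) \<in> ?base"
        by (auto simp: ultra_base_def intro: quotientI)
      then show ?thesis
        by blast
    qed
    show "carr (ultraproduct I D A) \<noteq> {}"
      using PA_nonempty by (simp add: carr_ultraproduct)
    show "star (ultraproduct I D A) \<kappa> X Y \<in> carr (ultraproduct I D A)"
      if "\<kappa> \<in> Field \<alpha>" "X \<in> carr (ultraproduct I D A)" "Y \<in> carr (ultraproduct I D A)" for \<kappa> X Y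
      using that(2,3) unfolding carr_ultraproduct
      by (elim quotientE) (simp only: star_class[OF that(1)] star_PA[OF that(1)] quotientI)
    show "var (ultraproduct I D A) \<kappa> \<in> carr (ultraproduct I D A)" if "\<kappa> \<in> Field \<alpha>" for \<kappa>
      using var_PA[OF that] by (simp only: carr_ultraproduct var_ultraproduct quotientI)
    show "?E X s \<in> ?base" if "X \<in> carr (ultraproduct I D A)" "s \<in> seqs \<alpha> ?base" for X s
      using that(1) unfolding carr_ultraproduct by (elim quotientE) (simp only: E_base that(2))
    show "?E (star (ultraproduct I D A) \<kappa> X Y) s = ?E Y (s(\<kappa> := ?E X s))"
      if \<kappa>: "\<kappa> \<in> Field \<alpha>" and XY: "X \<in> carr (ultraproduct I D A)" "Y \<in> carr (ultraproduct I D A)"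
        and s: "s \<in> seqs \<alpha> ?base" for \<kappa> X Y s
    proof
      fix t
      obtain x where x: "x \<in> ?PA" and X: "X = ?RA `` {x}"
        using XY(1) unfolding carr_ultraproduct by (elim quotientE)
      obtain y where y: "y \<in> ?PA" and Y: "Y = ?RA `` {y}"
        using XY(2) unfolding carr_ultraproduct by (elim quotientE)
      let ?xy = "\<lambda>i\<in>I. star (A i) \<kappa> (x i) (y i)" and ?c = "choose_rep t \<kappa> (?E X s t)"
      have s': "s(\<kappa> := ?E X s) \<in> seqs \<alpha> ?base"
        using seqs_upd[OF s _ \<kappa>] E_base[OF x s] X by simp
      have cls: "?E X s t \<in> ?PU // ?RU"
        using E_base[OF x s] X by (auto simp: ultra_base_def)
      \<comment> \<open>The lifted update inserts the chosen representative \<open>?c\<close> where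
        the factors produce \<open>?v x t s\<close>. The two agree D-almost everywhere, and since
        only position \<kappa> is affected, one such D-large set is enough even for infinite
        \<alpha>.\<close>
      have "?RU `` {?c} = ?RU `` {?v x t s}"
        using choose_rep_class(2)[OF cls] E_class[OF x s] X by simp
      then have "eventually (\<lambda>i. ?c i = ?v x t s i) D"
        by (rule filter_rel_class_eq_iff[OF choose_rep_class(1)[OF cls] v_PU[OF x s], THEN iffD1])
      then have "eventually (\<lambda>i. ?v ?xy t s i = ?v y t (s(\<kappa> := ?E X s)) i) D"
        using ev_I
      proof eventually_elim
        case (elim i)
        then have "x i \<in> carr (A i)" "y i \<in> carr (A i)" "lift_seq \<alpha> t s i \<in> seqs \<alpha> (U i)"
          using x y lift_seq_in_seqs[OF s] by auto
        then show ?case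
          using elim by (simp add: function_rep.eval_star[OF rep[OF elim(2)] \<kappa>] lift_seq_upd[OF \<kappa>])
      qed
      then have "?RU `` {?v ?xy t s} = ?RU `` {?v y t (s(\<kappa> := ?E X s))}"
        by (rule filter_rel_class_eq_iff[OF v_PU[OF star_PA[OF \<kappa> x y] s] v_PU[OF y s'], THEN iffD2])
      then show "?E (star (ultraproduct I D A) \<kappa> X Y) s t = ?E Y (s(\<kappa> := ?E X s)) t"
        unfolding E_class[OF star_PA[OF \<kappa> x y] s, symmetric] E_class[OF y s', symmetric]
        unfolding star_class[OF \<kappa> x y, symmetric] X[symmetric] Y[symmetric] .
    qed
    show "?E (var (ultraproduct I D A) \<kappa>) s = s \<kappa>"
      if \<kappa>: "\<kappa> \<in> Field \<alpha>" and s: "s \<in> seqs \<alpha> ?base" for \<kappa> s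
    proof
      fix t
      let ?x = "\<lambda>i\<in>I. var (A i) \<kappa>"
      note cls = seqs_ultra_base[OF s \<kappa>, of t]
      have "eventually (\<lambda>i. ?v ?x t s i = choose_rep t \<kappa> (s \<kappa> t) i) D"
        using ev_I
      proof eventually_elim
        case (elim i)
        then show ?case
          using lift_seq_in_seqs[OF s elim, of t] \<kappa>
          by (simp add: function_rep.eval_var[OF rep]) (simp add: lift_seq_def)
      qed
      then have "?RU `` {?v ?x t s} = ?RU `` {choose_rep t \<kappa> (s \<kappa> t)}"
        by (rule filter_rel_class_eq_iff[OF v_PU[OF var_PA[OF \<kappa>] s] choose_rep_class(1)[OF cls], THEN iffD2])
      then show "?E (var (ultraproduct I D A) \<kappa>) s t = s \<kappa> t"
        unfolding var_ultraproduct E_class[OF var_PA[OF \<kappa>] s] choose_rep_class(2)[OF cls] .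
    qed
    show "X = Y"
      if XY: "X \<in> carr (ultraproduct I D A)" "Y \<in> carr (ultraproduct I D A)"
        and eq: "\<And>s. s \<in> seqs \<alpha> ?base \<Longrightarrow> ?E X s = ?E Y s" for X Y
    proof -
      obtain x where x: "x \<in> ?PA" and X: "X = ?RA `` {x}"
        using XY(1) unfolding carr_ultraproduct by (elim quotientE)
      obtain y where y: "y \<in> ?PA" and Y: "Y = ?RA `` {y}"
        using XY(2) unfolding carr_ultraproduct by (elim quotientE)
      \<comment> \<open>Where \<open>x i\<close> and \<open>y i\<close> differ, \<open>p\<close> is
        a sequence separating them; where they agree, any sequence will do. The implication covers
        both cases in one choice.\<close>
      have "\<exists>p\<in>seqs \<alpha> (U i). e i (x i) p = e i (y i) p \<longrightarrow> x i = y i" if i: "i \<in> I" for i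
      proof (cases "x i = y i")
        case True
        obtain u where "u \<in> U i"
          using function_rep.base_nonempty[OF rep[OF i]] by blast
        then have "(\<lambda>\<kappa>\<in>Field \<alpha>. u) \<in> seqs \<alpha> (U i)"
          by (simp add: seqs_def)
        then show ?thesis
          using True by blast
      next
        case False
        then show ?thesis
          using function_rep.eval_inject[OF rep[OF i], of "x i" "y i"] x y i by blast
      qed
      then obtain p where p: "\<And>i. i \<in> I \<Longrightarrow> p i \<in> seqs \<alpha> (U i)"
        and sep: "\<And>i. i \<in> I \<Longrightarrow> e i (x i) (p i) = e i (y i) (p i) \<Longrightarrow> x i = y i"
        by metis
      \<comment> \<open>Transposing the separating sequences \<open>p i\<close> gives one point of
        the product for each position. The sequence \<open>s\<close> carries its class in every
        component, though only component \<open>t\<close> will be inspected.\<close>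
      define t where "t \<kappa> = (\<lambda>i\<in>I. p i \<kappa>)" for \<kappa>
      define s :: "'k \<Rightarrow> ('k \<Rightarrow> 'i \<Rightarrow> 'u) \<Rightarrow> ('i \<Rightarrow> 'u) set"
        where "s = (\<lambda>\<kappa>\<in>Field \<alpha>. \<lambda>_. ?RU `` {t \<kappa>})"
      have t_PU: "t \<kappa> \<in> ?PU" if "\<kappa> \<in> Field \<alpha>" for \<kappa>
        using p that by (auto simp: t_def seqs_def)
      then have s: "s \<in> seqs \<alpha> ?base"
        by (auto simp: s_def seqs_def ultra_base_def intro: quotientI)
      \<comment> \<open>Since \<open>t \<kappa>\<close> lies in its own class,
        \<open>choose_rep\<close> returns exactly it, not merely an equivalent point. Thus equality
        holds at every coordinate of \<open>I\<close>.\<close>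
      have lift: "lift_seq \<alpha> t s i = p i" if i: "i \<in> I" for i
      proof -
        have "t \<kappa> \<in> ?RU `` {t \<kappa>}" if "\<kappa> \<in> Field \<alpha>" for \<kappa>
          using equiv_class_self[OF equiv_filter_rel t_PU[OF that]] .
        then show ?thesis
          using p[OF i] i by (auto simp: lift_seq_def choose_rep_def s_def t_def seqs_def
              PiE_iff extensional_def fun_eq_iff)
      qed
      have "?RU `` {?v x t s} = ?RU `` {?v y t s}"
        using fun_cong[OF eq[OF s], of t] unfolding X Y E_class[OF x s] E_class[OF y s] .
      then have "eventually (\<lambda>i. ?v x t s i = ?v y t s i) D"
        by (rule filter_rel_class_eq_iff[OF v_PU[OF x s] v_PU[OF y s], THEN iffD1])
      \<comment> \<open>At each coordinate where the two values at \<open>p i\<close> agree, the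
        choice of \<open>p i\<close> forces \<open>x i = y i\<close>.\<close>
      then have "eventually (\<lambda>i. x i = y i) D"
        using ev_I by eventually_elim (simp add: lift sep)
      then show ?thesis
        unfolding X Y by (rule filter_rel_class_eq_iff[OF x y, THEN iffD2])
    qed
  qed
qed

theorem theorem3p6:
  fixes \<alpha> :: "'k rel"
    and I :: "'i set"
    and D :: "'i filter"
    and A :: "'i \<Rightarrow> ('k, 'a) sub_alg"
  assumes "Well_order \<alpha>"
    and "ultrafilter_on I D"
    and "\<And>i. i \<in> I \<Longrightarrow> representable_SA TYPE('u) \<alpha> (A i)"
  shows "representable_SA TYPE(('k \<Rightarrow> 'i \<Rightarrow> 'u) \<Rightarrow> ('i \<Rightarrow> 'u) set) \<alpha> (ultraproduct I D A)"
proof -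
  \<comment> \<open>Base sets and evaluations are chosen for all factors simultaneously.\<close>
  obtain U :: "'i \<Rightarrow> 'u set" and e where "\<And>i. i \<in> I \<Longrightarrow> function_rep \<alpha> (A i) (U i) (e i)"
    using representable_function_rep[OF assms(3)] by metis
  moreover have "D \<le> principal I"
    using assms(2) by (simp add: ultrafilter_on_def)
  ultimately show ?thesis
    by (intro function_rep.representable[OF function_rep_ultraproduct])
qed

end
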